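(* An equilibrium in a multiple-source-and-single-sink series parallel graph may not exist: assuming that the source producers make their decisions simultaneously, there exist a multiple-source-and-single-sink series parallel graph, positive production costs of its sources and market parameters $a_t,b_t>0$ with $a_t$ larger than all production costs, for which the sequential decision game has no equilibrium.
   Context: Graphs. A series parallel graph (SPG) with one source and one sink is a graph constructed from copies of the single-arc graph by series compositions (identify the sink of $X$ with the source of $Y$) and parallel compositions (identify the two sources and the two sinks). A multiple-source-and-single-sink SPG (MSSPG) is a graph obtained from an SPG by deleting its source node and setting the nodes adjacent to that source as the new source nodes. Game. Let $t$ be the sink (a market), and let the remaining nodes be source producers and intermediary firms (set $V$). An arc $ij$ means $i$ can sell to $j$; $B(i)=\{j: ij\in E\}$, $S(i)=\{k: ki\in E\}$. Each source $r$ has a constant unit production cost $p_r=a_r>0$. The sources move first, simultaneously; each firm moves once all its sellers have moved, observing their decisions. Firm $i\in V$ chooses buying quantities $0\le x^{in}_{ki}\le x^{out}_{ki}$ ($k\in S(i)$), selling quantities $x^{out}_{ij}\ge 0$ and prices $p_{ij}\ge 0$ ($j\in B(i)$); a source $r$ chooses $x^{out}_{rj}\ge0$, $p_{rj}\ge0$. The market accepts everything ($x^{in}_{it}=x^{out}_{it}$) and prices on arcs into $t$ are not chosen but equal $p_t=a_t-b_tX_t$, $X_t=\sum_{i\in S(t)}x^{in}_{it}$. Firms obtain goods only from their sellers and get no value from retained goods. Payoffs: $\Pi_r=\sum_{j\in B(r)}p_{rj}x^{in}_{rj}-p_r\sum_{j\in B(r)}x^{out}_{rj}$ for a source $r$ and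 $\Pi_i=\sum_{j\in B(i)}p_{ij}x^{in}_{ij}-\sum_{k\in S(i)}p_{ki}x^{in}_{ki}$ for $i\in V$. Equilibrium. A collection of (pure) strategies of all sources and firms such that (1) $x^{in}_{ij}=x^{out}_{ij}$ for every arc $ij$; (2) no source or intermediary firm $i$ can obtain a better payoff by changing its strategy, assuming each descendant firm of $i$ plays a best strategy maximizing its payoff and the strategies of non-descendants of $i$ stay the same. *)

theory Defs
  imports Complex_Main
begin

section \<open>Series parallel graphs\<close>

text \<open>
  \<open>spg N E s t\<close>: the node set \<open>N\<close> and arc set \<open>E\<close> form a series parallel graph with source \<open>s\<close>
  and sink \<open>t\<close>. Gluing of copies is expressed by letting the operands share exactly the nodes that
  are identified. An arc is a pair of nodes, so parallel composition requires disjoint arc sets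
  (two parallel copies of one arc \<open>(s, t)\<close> are not formed).
\<close>

inductive spg :: "'v set \<Rightarrow> ('v \<times> 'v) set \<Rightarrow> 'v \<Rightarrow> 'v \<Rightarrow> bool" where
  single_arc: "s \<noteq> t \<Longrightarrow> spg {s, t} {(s, t)} s t"
| series: "spg N1 E1 s m \<Longrightarrow> spg N2 E2 m t \<Longrightarrow> N1 \<inter> N2 = {m}
    \<Longrightarrow> spg (N1 \<union> N2) (E1 \<union> E2) s t"
| parallel: "spg N1 E1 s t \<Longrightarrow> spg N2 E2 s t \<Longrightarrow> N1 \<inter> N2 = {s, t} \<Longrightarrow> E1 \<inter> E2 = {}
    \<Longrightarrow> spg (N1 \<union> N2) (E1 \<union> E2) s t"

definition msspg :: "'v set \<Rightarrow> ('v \<times> 'v) set \<Rightarrow> 'v set \<Rightarrow> 'v \<Rightarrow> bool" where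
  "msspg N E R t \<longleftrightarrow> (\<exists>N0 E0 s. spg N0 E0 s t \<and>
     N = N0 - {s} \<and> E = {(i, j) \<in> E0. i \<noteq> s \<and> j \<noteq> s} \<and> R = {r. (s, r) \<in> E0})"


section \<open>The sequential decision game\<close>

text \<open>\<open>cost\<close> is only relevant on \<open>sources\<close>; the price in the market is
  \<open>intercept - slope * X\<close> when a total of \<open>X\<close> is sold there.\<close>

record 'v game =
  nodes :: "'v set"
  arcs :: "('v \<times> 'v) set"
  sources :: "'v set"
  sink :: 'v
  cost :: "'v \<Rightarrow> real"
  intercept :: real
  slope :: real

text \<open>
  A profile collects the decisions of all players. On an arc \<open>(i, j)\<close>, the seller \<open>i\<close> controls
  \<open>offered i j\<close> (the quantity $x^{out}_{ij}$) and, if \<open>j\<close> is not the sink, \<open>price i j\<close>; the buyer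
  \<open>j\<close> controls \<open>bought i j\<close> (the quantity $x^{in}_{ij}$). All other values are irrelevant.
\<close>

record 'v profile =
  offered :: "'v \<Rightarrow> 'v \<Rightarrow> real"
  bought :: "'v \<Rightarrow> 'v \<Rightarrow> real"
  price :: "'v \<Rightarrow> 'v \<Rightarrow> real"

definition buyers :: "'v game \<Rightarrow> 'v \<Rightarrow> 'v set" where
  "buyers G i = {j. (i, j) \<in> arcs G}"

definition sellers :: "'v game \<Rightarrow> 'v \<Rightarrow> 'v set" where
  "sellers G i = {k. (k, i) \<in> arcs G}"

definition players :: "'v game \<Rightarrow> 'v set" where
  "players G = nodes G - {sink G}"

definition descendants :: "'v game \<Rightarrow> 'v \<Rightarrow> 'v set" where
  "descendants G i = {j. (i, j) \<in> (arcs G)\<^sup>+ \<and> j \<noteq> sink G}"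

definition market_price :: "'v game \<Rightarrow> 'v profile \<Rightarrow> real" where
  "market_price G A = intercept G - slope G * (\<Sum>i\<in>sellers G (sink G). bought A i (sink G))"

definition arc_price :: "'v game \<Rightarrow> 'v profile \<Rightarrow> 'v \<Rightarrow> 'v \<Rightarrow> real" where
  "arc_price G A i j = (if j = sink G then market_price G A else price A i j)"

definition payoff :: "'v game \<Rightarrow> 'v profile \<Rightarrow> 'v \<Rightarrow> real" where
  "payoff G A i =
     (\<Sum>j\<in>buyers G i. arc_price G A i j * bought A i j) -
     (if i \<in> sources G then cost G i * (\<Sum>j\<in>buyers G i. offered A i j)
      else (\<Sum>k\<in>sellers G i. arc_price G A k i * bought A k i))"

definition legal_decision :: "'v game \<Rightarrow> 'v profile \<Rightarrow> 'v \<Rightarrow> bool" where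
  "legal_decision G A i \<longleftrightarrow>
     (\<forall>j\<in>buyers G i. 0 \<le> offered A i j \<and> (j \<noteq> sink G \<longrightarrow> 0 \<le> price A i j)) \<and>
     (i \<notin> sources G \<longrightarrow>
        (\<forall>k\<in>sellers G i. 0 \<le> bought A k i \<and> bought A k i \<le> offered A k i) \<and>
        (\<Sum>j\<in>buyers G i. offered A i j) \<le> (\<Sum>k\<in>sellers G i. bought A k i))"

definition legal_profile :: "'v game \<Rightarrow> 'v profile \<Rightarrow> bool" where
  "legal_profile G A \<longleftrightarrow> (\<forall>i\<in>players G. legal_decision G A i) \<and>
     (\<forall>i\<in>sellers G (sink G). bought A i (sink G) = offered A i (sink G))"

definition same_decision :: "'v game \<Rightarrow> 'v profile \<Rightarrow> 'v profile \<Rightarrow> 'v \<Rightarrow> bool" where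
  "same_decision G A A' i \<longleftrightarrow>
     (\<forall>k\<in>sellers G i. bought A k i = bought A' k i) \<and>
     (\<forall>j\<in>buyers G i. offered A i j = offered A' i j \<and>
        (j \<noteq> sink G \<longrightarrow> price A i j = price A' i j))"

text \<open>\<open>reaction G A i D A'\<close>: starting from \<open>A\<close>, player \<open>i\<close> switches to its decision in \<open>D\<close>, the
  descendants of \<open>i\<close> decide anew in some legal way, and nobody else changes; the result is \<open>A'\<close>.\<close>

definition reaction :: "'v game \<Rightarrow> 'v profile \<Rightarrow> 'v \<Rightarrow> 'v profile \<Rightarrow> 'v profile \<Rightarrow> bool" where
  "reaction G A i D A' \<longleftrightarrow> legal_profile G A' \<and> same_decision G D A' i \<and>
     (\<forall>j\<in>players G - descendants G i - {i}. same_decision G A A' j)"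

text \<open>
  \<open>plays_best G A i\<close>: player \<open>i\<close> cannot obtain a better payoff than in \<open>A\<close> by changing its decision,
  when its descendants then play best themselves and all other decisions stay the same.
  Best replies of the descendants need not be unique. A change is counted as an improvement if
  descendants have best replies to it and \<open>i\<close> is better off under all of them. Hence the
  descendants may break ties, separately after each change, in the way that best sustains \<open>A\<close>; no
  particular tie-breaking rule is imposed.
  The recursion descends along the arcs of a finite acyclic graph; these two properties hold for
  every graph satisfying \<open>msspg\<close> (see \<open>msspg_finite_acyclic\<close> below), and on other graphs the
  predicate is vacuously true.
\<close>

function plays_best :: "'v game \<Rightarrow> 'v profile \<Rightarrow> 'v \<Rightarrow> bool" where
  "plays_best G A i \<longleftrightarrow> (finite (arcs G) \<and> acyclic (arcs G) \<longrightarrow>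
     \<not> (\<exists>D.
        (\<exists>A'. reaction G A i D A' \<and> (\<forall>k\<in>descendants G i. plays_best G A' k)) \<and>
        (\<forall>A'. reaction G A i D A' \<and> (\<forall>k\<in>descendants G i. plays_best G A' k)
           \<longrightarrow> payoff G A i < payoff G A' i)))"
  by pat_completeness auto
termination
proof (relation "{((G, A', k), (G', A, i)). G = G' \<and> finite (arcs G) \<and> acyclic (arcs G) \<and>
    (i, k) \<in> (arcs G)\<^sup>+}", goal_cases)
  case 1
  let ?r = "\<lambda>G :: 'v game. if finite (arcs G) \<and> acyclic (arcs G) then ((arcs G)\<inverse>)\<^sup>+ else {}"
  have wf: "wf (?r G)" for G :: "'v game"
    by (auto intro: wf_trancl finite_acyclic_wf_converse)
  show ?case
  proof (rule wfUNIVI, clarify)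
    fix P :: "'v game \<times> 'v profile \<times> 'v \<Rightarrow> bool" and G A i
    assume step: "\<forall>x. (\<forall>y. (y, x) \<in> {((G, A', k), (G', A, i)). G = G' \<and> finite (arcs G) \<and>
      acyclic (arcs G) \<and> (i, k) \<in> (arcs G)\<^sup>+} \<longrightarrow> P y) \<longrightarrow> P x"
    have "\<forall>A. P (G, A, i)"
      using wf[of G]
    proof (induction i rule: wf_induct_rule)
      case (less i)
      show ?case
      proof
        fix A
        show "P (G, A, i)"
          by (rule step[rule_format]) (use less in \<open>auto simp: trancl_converse\<close>)
      qed
    qed
    then show "P (G, A, i)" ..
  qed
qed (auto simp: descendants_def)

declare plays_best.simps [simp del]

definition equilibrium :: "'v game \<Rightarrow> 'v profile \<Rightarrow> bool" where
  "equilibrium G A \<longleftrightarrow> legal_profile G A \<and>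
     (\<forall>(i, j)\<in>arcs G. bought A i j = offered A i j) \<and>
     (\<forall>i\<in>players G. plays_best G A i)"


section \<open>Finiteness and acyclicity\<close>

text \<open>Witness of acyclicity: a ranking of the nodes along which all arcs increase.\<close>

lemma spg_ranking:
  "spg N E s t \<Longrightarrow> finite N \<and> E \<subseteq> N \<times> N \<and> s \<in> N \<and> t \<in> N \<and>
     (\<exists>f :: 'v \<Rightarrow> real. (\<forall>(i, j)\<in>E. f i < f j) \<and> f s = 0 \<and> f t = 1)"
proof (induction rule: spg.induct)
  case (single_arc s t)
  then show ?case
    by (auto intro!: exI[of _ "\<lambda>x. if x = s then 0 else 1"])
next
  case (series N1 E1 s m N2 E2 t)
  from series.IH obtain f g :: "'v \<Rightarrow> real" where
    f: "\<forall>(i, j)\<in>E1. f i < f j" "f s = 0" "f m = 1" and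
    g: "\<forall>(i, j)\<in>E2. g i < g j" "g m = 0" "g t = 1" by blast
  define h where "h x = (if x \<in> N1 then f x / 2 else (1 + g x) / 2)" for x
  have h1: "h x = f x / 2" if "x \<in> N1" for x using that by (simp add: h_def)
  have h2: "h x = (1 + g x) / 2" if "x \<in> N2" for x
    using that series.hyps f g by (cases "x = m") (auto simp: h_def)
  have mem: "m \<in> N1" "s \<in> N1" "m \<in> N2" "t \<in> N2" "E1 \<subseteq> N1 \<times> N1" "E2 \<subseteq> N2 \<times> N2"
    using series.IH by auto
  have "h i < h j" if "(i, j) \<in> E1 \<union> E2" for i j
    using that
  proof
    assume e: "(i, j) \<in> E1"
    then have "i \<in> N1" "j \<in> N1" "f i < f j" using mem f by auto
    then show ?thesis by (simp add: h1)
  next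
    assume e: "(i, j) \<in> E2"
    then have "i \<in> N2" "j \<in> N2" "g i < g j" using mem g by auto
    then show ?thesis by (simp add: h2)
  qed
  then have "\<forall>(i, j)\<in>E1 \<union> E2. h i < h j" by auto
  moreover have "h s = 0" "h t = 1"
    using h1[of s] h2[of t] mem f g by simp_all
  ultimately show ?case using series.IH by blast
next
  case (parallel N1 E1 s t N2 E2)
  from parallel.IH obtain f g :: "'v \<Rightarrow> real" where
    f: "\<forall>(i, j)\<in>E1. f i < f j" "f s = 0" "f t = 1" and
    g: "\<forall>(i, j)\<in>E2. g i < g j" "g s = 0" "g t = 1" by blast
  define h where "h x = (if x \<in> N1 then f x else g x)" for x
  have h1: "h x = f x" if "x \<in> N1" for x using that by (simp add: h_def)
  have h2: "h x = g x" if "x \<in> N2" for x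
    using that parallel.hyps f g by (cases "x = s \<or> x = t") (auto simp: h_def)
  have mem: "s \<in> N1" "t \<in> N2" "E1 \<subseteq> N1 \<times> N1" "E2 \<subseteq> N2 \<times> N2"
    using parallel.IH by auto
  have "h i < h j" if "(i, j) \<in> E1 \<union> E2" for i j
    using that
  proof
    assume e: "(i, j) \<in> E1"
    then have "i \<in> N1" "j \<in> N1" "f i < f j" using mem f by auto
    then show ?thesis by (simp add: h1)
  next
    assume e: "(i, j) \<in> E2"
    then have "i \<in> N2" "j \<in> N2" "g i < g j" using mem g by auto
    then show ?thesis by (simp add: h2)
  qed
  then have "\<forall>(i, j)\<in>E1 \<union> E2. h i < h j" by auto
  moreover have "h s = 0" "h t = 1"
    using h1[of s] h2[of t] mem f g by simp_all
  ultimately show ?case using parallel.IH by blast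
qed

lemma msspg_finite_acyclic:
  assumes "msspg N E R t"
  shows "finite E" "acyclic E"
proof -
  from assms obtain N0 E0 s where s: "spg N0 E0 s t" "E \<subseteq> E0"
    unfolding msspg_def by blast
  then obtain f :: "'a \<Rightarrow> real" where f: "\<forall>(i, j)\<in>E0. f i < f j" and "finite E0"
    using spg_ranking[OF s(1)] by (meson finite_SigmaI finite_subset)
  then show "finite E" using s(2) finite_subset by blast
  have "f i < f j" if "(i, j) \<in> E\<^sup>+" for i j
    using that by (induction rule: trancl_induct) (use f s(2) in \<open>fastforce+\<close>)
  then show "acyclic E" by (auto simp: acyclic_def)
qed

end

theory Submission
  imports Defs "HOL-Analysis.Analysis"
begin

text \<open>
  Two sources with equal unit cost sell to one firm, which sells to the market. Since offered goods
  are produced in advance, this is a Bertrand-Edgeworth competition. In an equilibrium the firm buys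
  everything, and a source that sells can raise its price until it equals the marginal revenue of
  the firm; so all active sources charge the marginal revenue at the total quantity. If that price
  exceeds the cost, a source undercuts it slightly and takes over the whole trade. If it equals the
  cost, a source gains by offering half of its quantity at a higher price, which the firm accepts
  because its marginal revenue has risen.
\<close>

section \<open>Best replies of the firm\<close>

text \<open>Resold goods fetch the market price \<open>3 - z\<close>, for the intercept 3 and slope
  1 of \<open>fork_game\<close>. Purchases and resale are kept apart because bought goods may be
  discarded.\<close>

definition firm_profit :: "real \<Rightarrow> real \<Rightarrow> real \<Rightarrow> real \<Rightarrow> real \<Rightarrow> real" where
  "firm_profit p q y w z = (3 - z) * z - p * y - q * w"

definition feasible :: "real \<Rightarrow> real \<Rightarrow> real \<Rightarrow> real \<Rightarrow> real \<Rightarrow> bool" where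
  "feasible x x' y w z \<longleftrightarrow> 0 \<le> y \<and> y \<le> x \<and> 0 \<le> w \<and> w \<le> x' \<and> 0 \<le> z \<and> z \<le> y + w"

text \<open>The suppliers offer quantities \<open>x\<close> and \<open>x'\<close> at prices \<open>p\<close> and \<open>q\<close>; the firm buys \<open>y\<close> and \<open>w\<close>
  and resells \<open>z\<close>.\<close>

definition best_reply :: "real \<Rightarrow> real \<Rightarrow> real \<Rightarrow> real \<Rightarrow> real \<Rightarrow> real \<Rightarrow> real \<Rightarrow> bool" where
  "best_reply x p x' q y w z \<longleftrightarrow> feasible x x' y w z \<and>
     (\<forall>y' w' z'. feasible x x' y' w' z' \<longrightarrow> firm_profit p q y' w' z' \<le> firm_profit p q y w z)"

lemma best_replyD:
  assumes "best_reply x p x' q y w z" "feasible x x' y' w' z'"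
  shows "(3 - z') * z' - p * y' - q * w' \<le> (3 - z) * z - p * y - q * w"
  using assms by (auto simp: best_reply_def firm_profit_def)

lemma feasible_commute: "feasible x x' y w z \<longleftrightarrow> feasible x' x w y z"
  by (auto simp: feasible_def)

lemma best_reply_commute: "best_reply x p x' q y w z \<longleftrightarrow> best_reply x' q x p w y z"
proof -
  have "firm_profit p q y w z = firm_profit q p w y z" for p q y w z
    by (simp add: firm_profit_def)
  then show ?thesis
    unfolding best_reply_def by (metis feasible_commute)
qed

lemma best_reply_exists:
  assumes "0 \<le> x" "0 \<le> x'"
  shows "\<exists>y w z. best_reply x p x' q y w z"
proof -
  \<comment> \<open>The bound \<open>x + x'\<close> on the resale follows from the other
    constraints; it is added to make the set visibly compact.\<close>
  let ?S = "({0..x} \<times> {0..x'} \<times> {0..x + x'}) \<inter> {(y, w, z). z \<le> y + w}"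
  have "closed {(y, w, z :: real). z \<le> y + w}"
    unfolding case_prod_unfold by (intro closed_Collect_le continuous_intros)
  then have "compact ?S"
    by (intro compact_Int_closed compact_Times compact_Icc)
  moreover have "(0, 0, 0) \<in> ?S"
    using assms by simp
  moreover have "continuous_on ?S (\<lambda>(y, w, z). firm_profit p q y w z)"
    unfolding case_prod_unfold firm_profit_def by (intro continuous_intros)
  ultimately obtain m where m: "m \<in> ?S"
    "\<forall>m'\<in>?S. (\<lambda>(y, w, z). firm_profit p q y w z) m' \<le> (\<lambda>(y, w, z). firm_profit p q y w z) m"
    by (metis (no_types, lifting) continuous_attains_sup empty_iff)
  obtain y w z where "m = (y, w, z)"
    by (cases m)
  then have "best_reply x p x' q y w z"
    using m by (force simp: best_reply_def feasible_def)
  then show ?thesis by blast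
qed

text \<open>Here \<open>3 - 2 * s\<close> is the marginal revenue of reselling \<open>s\<close>. A
  unit bought no dearer than this would pay, and a strictly cheaper supplier is served before the
  other.\<close>

lemma best_reply_buys_all:
  assumes br: "best_reply x p x' q y w z"
    and "p < q \<and> p \<le> 3 - 2 * x \<or> p \<le> 3 - 2 * (x + x')"
  shows "y = x"
proof (rule ccontr)
  assume "y \<noteq> x"
  have f: "0 \<le> y" "y \<le> x" "0 \<le> w" "w \<le> x'" "0 \<le> z" "z \<le> y + w"
    using br by (auto simp: best_reply_def feasible_def)
  define d where "d = x - y"
  have "d > 0" using f \<open>y \<noteq> x\<close> by (simp add: d_def)
  \<comment> \<open>Buying and reselling the missing \<open>d\<close> must not pay.\<close>
  have "(3 - (z + d)) * (z + d) - p * x - q * w \<le> (3 - z) * z - p * y - q * w"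
    using f \<open>d > 0\<close> by (intro best_replyD[OF br]) (auto simp: feasible_def d_def)
  then have "d * (3 - 2 * z - d - p) \<le> 0"
    by (simp add: d_def algebra_simps)
  with \<open>d > 0\<close> have large: "3 - 2 * z - d - p \<le> 0"
    by (simp add: mult_le_0_iff)
  have "z + d \<le> x + x'"
    using f by (simp add: d_def)
  then have "\<not> p \<le> 3 - 2 * (x + x')"
    using large \<open>d > 0\<close> by simp
  then have pq: "p < q" "p \<le> 3 - 2 * x"
    using assms(2) by auto
  have "w = 0"
  proof (rule ccontr)
    assume "w \<noteq> 0"
    define e where "e = min d w"
    have e: "0 < e" "e \<le> d" "e \<le> w"
      using f \<open>w \<noteq> 0\<close> \<open>d > 0\<close> by (auto simp: e_def)
    \<comment> \<open>Shifting \<open>e\<close> units to the cheaper supplier leaves the resale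
      unchanged and saves \<open>(q - p) * e\<close>.\<close>
    have "(3 - z) * z - p * (y + e) - q * (w - e) \<le> (3 - z) * z - p * y - q * w"
      using f e by (intro best_replyD[OF br]) (auto simp: feasible_def d_def)
    then have "(q - p) * e \<le> 0"
      by (simp add: algebra_simps)
    then show False
      using pq e by (simp add: mult_le_0_iff)
  qed
  then show False
    using large pq f \<open>d > 0\<close> unfolding d_def by linarith
qed

lemma price_le_marginal_revenue:
  assumes br: "best_reply x p x' q x x' z" and "0 < x" "0 < p"
  shows "p \<le> 3 - 2 * (x + x')"
proof (rule ccontr)
  assume *: "\<not> p \<le> 3 - 2 * (x + x')"
  have f: "0 \<le> x'" "0 \<le> z" "z \<le> x + x'"
    using br by (auto simp: best_reply_def feasible_def)
  have z: "z = x + x'"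
  proof (rule ccontr)
    assume "z \<noteq> x + x'"
    define e where "e = min x (x + x' - z)"
    have e: "0 < e" "e \<le> x" "e \<le> x + x' - z"
      using f \<open>z \<noteq> x + x'\<close> \<open>0 < x\<close> by (auto simp: e_def)
    have "(3 - z) * z - p * (x - e) - q * x' \<le> (3 - z) * z - p * x - q * x'"
      using f e by (intro best_replyD[OF br]) (auto simp: feasible_def)
    then have "p * e \<le> 0"
      by (simp add: algebra_simps)
    then show False
      using e \<open>0 < p\<close> by (simp add: mult_le_0_iff)
  qed
  \<comment> \<open>Cutting purchase and resale by \<open>d\<close> changes the profit by
    \<open>d * (p - (3 - 2 * z) - d)\<close>, positive when \<open>d\<close> is at most half of the
    excess of \<open>p\<close> over the marginal revenue.\<close>
  define d where "d = min x ((p - (3 - 2 * z)) / 2)"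
  have d: "0 < d" "d \<le> x" "2 * d \<le> p - (3 - 2 * z)"
    using * \<open>0 < x\<close> by (auto simp: d_def z min_def)
  have "(3 - (z - d)) * (z - d) - p * (x - d) - q * x' \<le> (3 - z) * z - p * x - q * x'"
    using f d by (intro best_replyD[OF br]) (auto simp: feasible_def z)
  then have "0 \<le> d * (3 - 2 * z + d - p)"
    by (simp add: algebra_simps)
  then show False
    using d by (simp add: zero_le_mult_iff)
qed

section \<open>Competition of the sources\<close>

text \<open>A source that offers \<open>x\<close> at price \<open>p\<close>, all of which is bought, cannot be sure to gain from any
  other offer while its competitor offers \<open>x'\<close> at price \<open>q\<close>.\<close>

definition content :: "real \<Rightarrow> real \<Rightarrow> real \<Rightarrow> real \<Rightarrow> bool" where
  "content x p x' q \<longleftrightarrow> (\<forall>u r. 0 \<le> u \<longrightarrow> 0 \<le> r \<longrightarrow>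
     (\<exists>y w z. best_reply u r x' q y w z \<and> r * y - u \<le> p * x - x))"

text \<open>Under the condition on \<open>r\<close> all best replies buy all of \<open>u\<close>, so
  the choice among best replies cannot deter the deviation.\<close>

lemma content_bound:
  assumes "content x p x' q" "0 \<le> u" "0 \<le> r"
    and "r < q \<and> r \<le> 3 - 2 * u \<or> r \<le> 3 - 2 * (u + x')"
  shows "(r - 1) * u \<le> (p - 1) * x"
proof -
  obtain y w z where *: "best_reply u r x' q y w z" "r * y - u \<le> p * x - x"
    using assms unfolding content_def by blast
  then have "y = u"
    using best_reply_buys_all assms(4) by blast
  then show ?thesis using * by (simp add: algebra_simps)
qed

lemma content_price:
  assumes c: "content x p x' q" and br: "best_reply x p x' q x x' z" and "0 < x"
  shows "1 \<le> p" "p = 3 - 2 * (x + x')"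
proof -
  \<comment> \<open>The empty offer earns zero, so the present profit is nonnegative.\<close>
  obtain y w z' where "best_reply 0 1 x' q y w z'" "1 * y - 0 \<le> p * x - x"
    using c unfolding content_def by (metis order_refl zero_le_one)
  moreover from this have "y = 0"
    by (simp add: best_reply_def feasible_def)
  ultimately have "0 \<le> (p - 1) * x"
    by (simp add: algebra_simps)
  then show "1 \<le> p"
    using \<open>0 < x\<close> by (simp add: zero_le_mult_iff)
  then have le: "p \<le> 3 - 2 * (x + x')"
    using price_le_marginal_revenue[OF br] \<open>0 < x\<close> by simp
  \<comment> \<open>The deviation keeps \<open>x\<close> and raises the price to the marginal
    revenue.\<close>
  then have "(3 - 2 * (x + x') - 1) * x \<le> (p - 1) * x"
    using \<open>1 \<le> p\<close> \<open>0 < x\<close> by (intro content_bound[OF c]) auto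
  then show "p = 3 - 2 * (x + x')"
    using le \<open>0 < x\<close> by simp
qed

lemma content_price_gt_cost:
  assumes c: "content x p x' q" and br: "best_reply x p x' q x x' z" and "0 < x"
  shows "1 < p"
proof (rule ccontr)
  assume "\<not> 1 < p"
  then have p: "p = 1" "3 - 2 * (x + x') = 1"
    using content_price[OF c br \<open>0 < x\<close>] by auto
  \<comment> \<open>At the total quantity \<open>x / 2 + x'\<close> the marginal revenue is exactly
    \<open>1 + x\<close>, whereas the present profit is zero.\<close>
  have "(1 + x - 1) * (x / 2) \<le> (p - 1) * x"
    using p \<open>0 < x\<close> by (intro content_bound[OF c]) (auto simp: field_simps)
  then show False
    using p \<open>0 < x\<close> by (simp add: mult_le_0_iff)
qed

lemma not_both_content:
  assumes c: "content x p x' q" and c': "content x' q x p" and br: "best_reply x p x' q x x' z"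
  shows False
proof -
  have br': "best_reply x' q x p x' x z"
    using br best_reply_commute by blast
  have nonneg: "0 \<le> x" "0 \<le> x'"
    using br by (auto simp: best_reply_def feasible_def)
  \<comment> \<open>An active source is undercut by its competitor, active or not, which takes over the whole
    trade at a price \<open>r\<close> that shares the gain.\<close>
  have undercut: "\<not> 0 < x"
    if c: "content x p x' q" and c': "content x' q x p" and br: "best_reply x p x' q x x' z"
      and "0 \<le> x'" for x p x' q
  proof
    assume "0 < x"
    define s where "s = x + x'"
    \<comment> \<open>With this \<open>t\<close> the deviator earns
      \<open>(p - 1) * (x' + x / 2)\<close>, halfway between \<open>(p - 1) * x'\<close> and the
      whole gain \<open>(p - 1) * s\<close>; \<open>t < 1\<close> makes the price undercut
      \<open>p\<close>.\<close>
    define t where "t = (x' + x / 2) / s"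
    define r where "r = 1 + (p - 1) * t"
    have "0 < s" using \<open>0 < x\<close> \<open>0 \<le> x'\<close> by (simp add: s_def)
    have t: "t * s = x' + x / 2" "0 < t" "t < 1"
      using \<open>0 < x\<close> \<open>0 \<le> x'\<close> by (auto simp: t_def s_def field_simps)
    have p: "1 < p" "p = 3 - 2 * s"
      using content_price[OF c br \<open>0 < x\<close>] content_price_gt_cost[OF c br \<open>0 < x\<close>]
      by (auto simp: s_def)
    have r: "1 < r" "r < p"
      using p t mult_strict_left_mono[of t 1 "p - 1"] by (auto simp: r_def)
    have "(r - 1) * s \<le> (q - 1) * x'"
      using r p \<open>0 < s\<close> by (intro content_bound[OF c']) auto
    also have "(q - 1) * x' = (p - 1) * x'"
    \<comment> \<open>An inactive competitor may quote any \<open>q\<close>, but then both products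
      vanish.\<close>
    proof (cases "x' = 0")
      case False
      have "best_reply x' q x p x' x z"
        using br best_reply_commute by blast
      then have "q = 3 - 2 * (x' + x)"
        using content_price[OF c'] False \<open>0 \<le> x'\<close> by simp
      then show ?thesis using p by (simp add: s_def)
    qed simp
    also have "(r - 1) * s = (p - 1) * (x' + x / 2)"
      by (simp add: r_def mult.assoc t(1))
    finally show False
      using p \<open>0 < x\<close> by simp
  qed
  have "x = 0" "x' = 0"
    using undercut[OF c c' br] undercut[OF c' c br'] nonneg by auto
  \<comment> \<open>If nobody trades, offering \<open>1 / 2\<close> at its marginal revenue 2 gains
    \<open>1 / 2\<close>.\<close>
  moreover have "(2 - 1) * (1 / 2) \<le> (p - 1) * x"
    using \<open>x' = 0\<close> by (intro content_bound[OF c]) auto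
  ultimately show False by simp
qed

section \<open>The game\<close>

declare One_nat_def [simp del]

text \<open>Node 0 is left free for the source that \<open>msspg\<close> deletes.\<close>

definition fork_game :: "nat game" where
  "fork_game = \<lparr>nodes = {1, 2, 3, 4}, arcs = {(1, 3), (2, 3), (3, 4)}, sources = {1, 2}, sink = 4,
     cost = \<lambda>_. 1, intercept = 3, slope = 1\<rparr>"

lemma msspg_fork_game:
  "msspg (nodes fork_game) (arcs fork_game) (sources fork_game) (sink fork_game)"
proof -
  have path: "spg ({0, i} \<union> {i, 3}) ({(0, i)} \<union> {(i, 3)}) 0 3" if "i \<in> {1, 2}" for i :: nat
    using that by (intro spg.series[OF spg.single_arc spg.single_arc]) auto
  have "spg (({0, 1} \<union> {1, 3}) \<union> ({0, 2} \<union> {2, 3}))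
     (({(0, 1)} \<union> {(1, 3)}) \<union> ({(0, 2)} \<union> {(2, 3)})) 0 (3 :: nat)"
    by (intro spg.parallel path) auto
  then have "spg ((({0, 1} \<union> {1, 3}) \<union> ({0, 2} \<union> {2, 3})) \<union> {3, 4})
     ((({(0, 1)} \<union> {(1, 3)}) \<union> ({(0, 2)} \<union> {(2, 3)})) \<union> {(3, 4)}) 0 (4 :: nat)"
    by (rule spg.series) (auto intro: spg.single_arc)
  moreover have "(({0, 1} \<union> {1, 3}) \<union> ({0, 2} \<union> {2, 3})) \<union> {3, 4} = {0 :: nat, 1, 2, 3, 4}"
    by auto
  moreover have "(({(0 :: nat, 1 :: nat)} \<union> {(1, 3)}) \<union> ({(0, 2)} \<union> {(2, 3)})) \<union> {(3, 4)} =
     {(0 :: nat, 1 :: nat), (0, 2), (1, 3), (2, 3), (3, 4)}"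
    by auto
  ultimately have "spg {0, 1, 2, 3, 4} {(0, 1), (0, 2), (1, 3), (2, 3), (3, 4)} 0 (4 :: nat)"
    by simp
  then show ?thesis
    unfolding msspg_def
    by (intro exI[of _ "{0, 1, 2, 3, 4}"] exI[of _ "{(0, 1), (0, 2), (1, 3), (2, 3), (3, 4)}"]
        exI[of _ 0])
      (auto simp: fork_game_def)
qed

lemma fork_game_sets:
  "buyers fork_game 1 = {3}" "buyers fork_game 2 = {3}" "buyers fork_game 3 = {4}"
  "sellers fork_game 1 = {}" "sellers fork_game 2 = {}" "sellers fork_game 3 = {1, 2}"
  "sellers fork_game 4 = {3}" "players fork_game = {1, 2, 3}" "sink fork_game = 4"
  "sources fork_game = {1, 2}" "cost fork_game i = 1"
  by (auto simp: fork_game_def buyers_def sellers_def players_def)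

lemma fork_game_descendants:
  "descendants fork_game 1 = {3}" "descendants fork_game 2 = {3}" "descendants fork_game 3 = {}"
proof -
  have *: "(i, j) \<in> (arcs fork_game)\<^sup>+ \<longleftrightarrow> (i, j) \<in> {(1, 3), (2, 3), (3, 4), (1, 4), (2, 4)}" for i j
  proof
    show "(i, j) \<in> {(1, 3), (2, 3), (3, 4), (1, 4), (2, 4)}" if "(i, j) \<in> (arcs fork_game)\<^sup>+"
      using that by (induction rule: trancl_induct) (auto simp: fork_game_def)
    have "(1, 3) \<in> arcs fork_game" "(2, 3) \<in> arcs fork_game" "(3, 4) \<in> arcs fork_game"
      by (auto simp: fork_game_def)
    then show "(i, j) \<in> (arcs fork_game)\<^sup>+" if "(i, j) \<in> {(1, 3), (2, 3), (3, 4), (1, 4), (2, 4)}"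
      using that by (auto intro: trancl_into_trancl)
  qed
  show "descendants fork_game 1 = {3}" "descendants fork_game 2 = {3}"
    "descendants fork_game 3 = {}"
    unfolding descendants_def * by (auto simp: fork_game_sets)
qed

text \<open>The recursion with its graph conditions discharged and the negation pushed inward: each
  change that admits best replies has one that does not improve the payoff.\<close>

lemma plays_best_fork_game:
  "plays_best fork_game A i \<longleftrightarrow>
     (\<forall>D. (\<exists>A'. reaction fork_game A i D A' \<and>
        (\<forall>k\<in>descendants fork_game i. plays_best fork_game A' k)) \<longrightarrow>
      (\<exists>A'. reaction fork_game A i D A' \<and>
        (\<forall>k\<in>descendants fork_game i. plays_best fork_game A' k) \<and>
        payoff fork_game A' i \<le> payoff fork_game A i))"
  using msspg_finite_acyclic[OF msspg_fork_game] unfolding linorder_not_less[symmetric]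
  by (subst plays_best.simps) blast

lemma legal_profile_fork_game:
  "legal_profile fork_game A \<longleftrightarrow>
     0 \<le> offered A 1 3 \<and> 0 \<le> price A 1 3 \<and> 0 \<le> offered A 2 3 \<and> 0 \<le> price A 2 3 \<and>
     feasible (offered A 1 3) (offered A 2 3) (bought A 1 3) (bought A 2 3) (offered A 3 4) \<and>
     bought A 3 4 = offered A 3 4"
  by (auto simp: legal_profile_def legal_decision_def fork_game_sets feasible_def)

lemma payoff_source: "i \<in> {1, 2} \<Longrightarrow> payoff fork_game A i = price A i 3 * bought A i 3 - offered A i 3"
  by (auto simp: payoff_def fork_game_sets arc_price_def)

lemma payoff_firm:
  assumes "legal_profile fork_game A"
  shows "payoff fork_game A 3 =
    firm_profit (price A 1 3) (price A 2 3) (bought A 1 3) (bought A 2 3) (offered A 3 4)"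
  using assms
  by (simp add: payoff_def fork_game_sets arc_price_def market_price_def firm_profit_def
      legal_profile_fork_game) (simp add: fork_game_def)

text \<open>Only values on arcs matter; the price that node 3 receives here is irrelevant because it
  sells to the market.\<close>

definition outcome ::
  "real \<Rightarrow> real \<Rightarrow> real \<Rightarrow> real \<Rightarrow> real \<Rightarrow> real \<Rightarrow> real \<Rightarrow> nat profile" where
  "outcome x p x' q y w z =
     \<lparr>offered = (\<lambda>i _. if i = 1 then x else if i = 2 then x' else z),
      bought = (\<lambda>i _. if i = 1 then y else if i = 2 then w else z),
      price = (\<lambda>i _. if i = 1 then p else q)\<rparr>"

lemma outcome_simps:
  "offered (outcome x p x' q y w z) 1 j = x" "offered (outcome x p x' q y w z) 2 j = x'"
  "offered (outcome x p x' q y w z) 3 j = z" "bought (outcome x p x' q y w z) 1 j = y"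
  "bought (outcome x p x' q y w z) 2 j = w" "bought (outcome x p x' q y w z) 3 j = z"
  "price (outcome x p x' q y w z) 1 j = p" "price (outcome x p x' q y w z) 2 j = q"
  by (simp_all add: outcome_def)

text \<open>The firm has no descendants, so its decision fixes the reaction on all arcs and no
  choice of replies remains.\<close>

lemma plays_best_firm:
  assumes legal: "legal_profile fork_game A"
  shows "plays_best fork_game A 3 \<longleftrightarrow>
    best_reply (offered A 1 3) (price A 1 3) (offered A 2 3) (price A 2 3)
      (bought A 1 3) (bought A 2 3) (offered A 3 4)"
proof
  assume best: "plays_best fork_game A 3"
  have "firm_profit (price A 1 3) (price A 2 3) y w z
      \<le> firm_profit (price A 1 3) (price A 2 3) (bought A 1 3) (bought A 2 3) (offered A 3 4)"
    if f: "feasible (offered A 1 3) (offered A 2 3) y w z" for y w z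
  proof -
    define D where
      "D = outcome (offered A 1 3) (price A 1 3) (offered A 2 3) (price A 2 3) y w z"
    have "reaction fork_game A 3 D D"
      using legal f
      by (auto simp: reaction_def legal_profile_fork_game fork_game_descendants same_decision_def
          fork_game_sets D_def outcome_simps)
    then obtain A' where A': "reaction fork_game A 3 D A'"
      "payoff fork_game A' 3 \<le> payoff fork_game A 3"
      using best unfolding plays_best_fork_game[of A] fork_game_descendants by blast
    then have "legal_profile fork_game A'" and
      "price A' 1 3 = price A 1 3" "price A' 2 3 = price A 2 3"
      "bought A' 1 3 = y" "bought A' 2 3 = w" "offered A' 3 4 = z"
      by (auto simp: reaction_def fork_game_descendants same_decision_def
          fork_game_sets D_def outcome_simps)
    then show ?thesis
      using A'(2) legal by (simp add: payoff_firm)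
  qed
  then show "best_reply (offered A 1 3) (price A 1 3) (offered A 2 3) (price A 2 3)
      (bought A 1 3) (bought A 2 3) (offered A 3 4)"
    using legal unfolding best_reply_def legal_profile_fork_game by blast
next
  assume br: "best_reply (offered A 1 3) (price A 1 3) (offered A 2 3) (price A 2 3)
      (bought A 1 3) (bought A 2 3) (offered A 3 4)"
  have "payoff fork_game A' 3 \<le> payoff fork_game A 3" if "reaction fork_game A 3 D A'" for D A'
  proof -
    from that have legal': "legal_profile fork_game A'" and
      same: "price A' 1 3 = price A 1 3" "price A' 2 3 = price A 2 3"
      "offered A' 1 3 = offered A 1 3" "offered A' 2 3 = offered A 2 3"
      by (auto simp: reaction_def fork_game_descendants same_decision_def fork_game_sets)
    then have "feasible (offered A 1 3) (offered A 2 3)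
        (bought A' 1 3) (bought A' 2 3) (offered A' 3 4)"
      by (simp add: legal_profile_fork_game)
    then show ?thesis
      using br legal legal' same unfolding best_reply_def by (simp add: payoff_firm)
  qed
  then show "plays_best fork_game A 3"
    unfolding plays_best_fork_game[of A] fork_game_descendants by blast
qed

lemma source_content:
  assumes legal: "legal_profile fork_game A"
    and best: "plays_best fork_game A i" and all: "bought A i 3 = offered A i 3"
    and ij: "(i, j) \<in> {(1, 2), (2, 1)}"
  shows "content (offered A i 3) (price A i 3) (offered A j 3) (price A j 3)"
  unfolding content_def
proof (intro allI impI)
  fix u r :: real
  assume nonneg: "0 \<le> u" "0 \<le> r"
  have "0 \<le> offered A j 3"
    using legal ij by (auto simp: legal_profile_fork_game)
  then obtain y w z where br: "best_reply u r (offered A j 3) (price A j 3) y w z"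
    using best_reply_exists nonneg by blast
  \<comment> \<open>A deviation counts only if best replies to it exist. \<open>D\<close> includes
    such a reply and is thus its own reaction; the reply in \<open>A'\<close> below may be a
    different one.\<close>
  define D where "D = (if i = 1 then outcome u r (offered A j 3) (price A j 3) y w z
    else outcome (offered A j 3) (price A j 3) u r w y z)"
  have D: "offered D i 3 = u" "price D i 3 = r"
    "best_reply (offered D 1 3) (price D 1 3) (offered D 2 3) (price D 2 3)
      (bought D 1 3) (bought D 2 3) (offered D 3 4)"
    using ij br best_reply_commute by (auto simp: D_def outcome_simps)
  have reaction_D: "reaction fork_game A i D D"
    using legal nonneg ij D(3)
    by (auto simp: reaction_def legal_profile_fork_game fork_game_descendants same_decision_def
        fork_game_sets D_def outcome_simps best_reply_def)
  then have "legal_profile fork_game D"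
    by (simp add: reaction_def)
  then have "plays_best fork_game D 3"
    using D(3) plays_best_firm by blast
  moreover have "descendants fork_game i = {3}"
    using ij by (auto simp: fork_game_descendants)
  ultimately obtain A' where A': "reaction fork_game A i D A'" "plays_best fork_game A' 3"
      "payoff fork_game A' i \<le> payoff fork_game A i"
    using best reaction_D unfolding plays_best_fork_game[of A] by auto
  have same: "offered A' i 3 = u" "price A' i 3 = r"
    "offered A' j 3 = offered A j 3" "price A' j 3 = price A j 3"
    using A'(1) D ij
    by (auto simp: reaction_def fork_game_descendants same_decision_def fork_game_sets)
  have "best_reply (offered A' 1 3) (price A' 1 3) (offered A' 2 3) (price A' 2 3)
      (bought A' 1 3) (bought A' 2 3) (offered A' 3 4)"
    using A' plays_best_firm by (simp add: reaction_def)
  then have "best_reply u r (offered A j 3) (price A j 3)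
      (bought A' i 3) (bought A' j 3) (offered A' 3 4)"
    using ij same best_reply_commute by auto
  moreover have "r * bought A' i 3 - u \<le> price A i 3 * offered A i 3 - offered A i 3"
    using A'(3) ij same all by (auto simp: payoff_source)
  ultimately show "\<exists>y w z. best_reply u r (offered A j 3) (price A j 3) y w z \<and>
      r * y - u \<le> price A i 3 * offered A i 3 - offered A i 3"
    by blast
qed

lemma no_equilibrium_fork_game: "\<not> equilibrium fork_game A"
proof
  assume "equilibrium fork_game A"
  then have legal: "legal_profile fork_game A"
    and best: "plays_best fork_game A 1" "plays_best fork_game A 2" "plays_best fork_game A 3"
    and all: "bought A 1 3 = offered A 1 3" "bought A 2 3 = offered A 2 3"
    unfolding equilibrium_def fork_game_sets by (auto simp: fork_game_def)
  have "content (offered A 1 3) (price A 1 3) (offered A 2 3) (price A 2 3)"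
    "content (offered A 2 3) (price A 2 3) (offered A 1 3) (price A 1 3)"
    using source_content[OF legal] best all by auto
  moreover have "best_reply (offered A 1 3) (price A 1 3) (offered A 2 3) (price A 2 3)
      (offered A 1 3) (offered A 2 3) (offered A 3 4)"
    using plays_best_firm[OF legal] best all by simp
  ultimately show False
    by (rule not_both_content)
qed

theorem proposition5p3:
  shows "\<exists>G :: nat game.
    msspg (nodes G) (arcs G) (sources G) (sink G) \<and>
    2 \<le> card (sources G) \<and> sink G \<notin> sources G \<and> (\<forall>r\<in>sources G. sellers G r = {}) \<and>
    (\<forall>r\<in>sources G. 0 < cost G r \<and> cost G r < intercept G) \<and>
    0 < intercept G \<and> 0 < slope G \<and>
    \<not> (\<exists>A. equilibrium G A)"
proof (intro exI[of _ fork_game] conjI)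
  show "\<not> (\<exists>A. equilibrium fork_game A)"
    using no_equilibrium_fork_game by blast
  show "msspg (nodes fork_game) (arcs fork_game) (sources fork_game) (sink fork_game)"
    by (rule msspg_fork_game)
  show "\<forall>r\<in>sources fork_game. sellers fork_game r = {}"
    using fork_game_sets by simp
qed (auto simp: fork_game_def)

end
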